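(* Let $K,L\subseteq\mathbb{R}^n$ be convex bodies and let $C(K,L)=\mathrm{conv}\big((L\times\{0\})\cup(-K\times\{1\})\big)\subseteq\mathbb{R}^{n+1}$. For every $\theta\in[0,1]$, \[ \mathrm{Vol}_{n+1}\big(C(K,L)\big)\le \frac{1}{n+1}\cdot\frac{\mathrm{Vol}_n(K)\,\mathrm{Vol}_n(L)}{\mathrm{Vol}_n\big(\theta K\cap(1-\theta)L\big)}. \]
   Context: A convex body is a compact convex subset of $\mathbb{R}^n$ with non-empty interior. $\mathrm{Vol}_m$ denotes $m$-dimensional Lebesgue measure. *)

theory Defs
  imports "HOL-Analysis.Analysis"
begin

text \<open>A convex body: compact convex set with non-empty interior.\<close>
definition convex_body :: "'a::euclidean_space set \<Rightarrow> bool" where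
  "convex_body K \<longleftrightarrow> compact K \<and> convex K \<and> interior K \<noteq> {}"

text \<open>C(K,L) = conv((L x {0}) union (-K x {1})) in R^n x R = R^(n+1).\<close>
definition cone_body :: "'a::euclidean_space set \<Rightarrow> 'a set \<Rightarrow> ('a \<times> real) set" where
  "cone_body K L = convex hull ((\<lambda>x. (x, 0::real)) ` L \<union> (\<lambda>x. (- x, 1::real)) ` K)"

end

theory Submission
  imports Defs
begin

text \<open>
  Double counting. Let \<open>E\<close> be the set of points \<open>((x, t), y)\<close> with \<open>0 \<le> t \<le> 1\<close>,
  \<open>y \<in> (1 - t) L\<close> and \<open>y - x \<in> t K\<close>. For fixed \<open>t\<close>, Fubini in \<open>(x, y)\<close> gives a slice of volume
  \<open>t^n (1 - t)^n |K| |L|\<close>, so \<open>|E| = B |K| |L|\<close> with \<open>B = \<integral>\<^sub>0\<^sup>1 t^n (1 - t)^n dt\<close>.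
  Conversely, let \<open>M = \<theta> K \<inter> (1 - \<theta>) L\<close> and \<open>p = (0, \<theta>)\<close>. Every \<open>c \<in> C(K, L)\<close> has the form
  \<open>((1 - s) l - s k, s)\<close>, and convexity shows that the fibre of \<open>E\<close> over \<open>u p + (1 - u) c\<close> contains a
  translate of \<open>u M\<close>, hence has volume at least \<open>u^n |M|\<close>. Integrating the density \<open>n u^(n-1)\<close> over
  the cone of these points, whose \<open>u\<close>-slice is \<open>C(K, L)\<close> scaled by \<open>1 - u\<close>, yields
  \<open>|M| |C(K, L)| \<integral>\<^sub>0\<^sup>1 n u^(n-1) (1 - u)^(n+1) du \<le> |E|\<close>; by parts the last integral is \<open>(n + 1) B\<close>.
\<close>

section \<open>The cone body\<close>

lemma convex_scaleR_add_rescale: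
  fixes S :: "'a::real_vector set"
  assumes "convex S" "u \<in> S" "v \<in> S" "0 \<le> a" "0 \<le> b"
  obtains w where "w \<in> S" "a *\<^sub>R u + b *\<^sub>R v = (a + b) *\<^sub>R w"
proof (cases "a + b = 0")
  case True
  then have "a = 0" "b = 0"
    using assms by auto
  then show ?thesis
    using assms that[of u] by simp
next
  case False
  then have pos: "a + b > 0" using assms by auto
  let ?w = "(a / (a + b)) *\<^sub>R u + (b / (a + b)) *\<^sub>R v"
  have "?w \<in> S"
    using assms pos by (intro convexD) (auto simp: add_divide_distrib[symmetric])
  moreover have "a *\<^sub>R u + b *\<^sub>R v = (a + b) *\<^sub>R ?w"
    using pos by (simp add: scaleR_add_right)
  ultimately show ?thesis using that by blast
qed

definition cone_sections :: "'a::real_vector set \<Rightarrow> 'a set \<Rightarrow> ('a \<times> real) set" where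
  "cone_sections K L = {(x, t). 0 \<le> t \<and> t \<le> 1 \<and> (\<exists>l\<in>L. \<exists>k\<in>K. x = (1 - t) *\<^sub>R l - t *\<^sub>R k)}"

lemma convex_cone_sections:
  assumes "convex K" "convex L"
  shows "convex (cone_sections K L)"
proof (rule convexI)
  fix p1 p2 :: "'a \<times> real" and a b :: real
  assume "p1 \<in> cone_sections K L" "p2 \<in> cone_sections K L" and ab: "0 \<le> a" "0 \<le> b" "a + b = 1"
  then obtain t1 l1 k1 t2 l2 k2 where
    p: "p1 = ((1 - t1) *\<^sub>R l1 - t1 *\<^sub>R k1, t1)" "p2 = ((1 - t2) *\<^sub>R l2 - t2 *\<^sub>R k2, t2)" and
    t: "0 \<le> t1" "t1 \<le> 1" "0 \<le> t2" "t2 \<le> 1" and lk: "l1 \<in> L" "k1 \<in> K" "l2 \<in> L" "k2 \<in> K"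
    by (auto simp: cone_sections_def)
  define t where "t = a * t1 + b * t2"
  have "a * (1 - t1) + b * (1 - t2) = 1 - t"
    using ab by (simp add: t_def algebra_simps)
  then obtain l where l: "l \<in> L" "(a * (1 - t1)) *\<^sub>R l1 + (b * (1 - t2)) *\<^sub>R l2 = (1 - t) *\<^sub>R l"
    using convex_scaleR_add_rescale[OF assms(2) lk(1,3), of "a * (1 - t1)" "b * (1 - t2)"] ab t
    by auto
  obtain k where k: "k \<in> K" "(a * t1) *\<^sub>R k1 + (b * t2) *\<^sub>R k2 = t *\<^sub>R k"
    using convex_scaleR_add_rescale[OF assms(1) lk(2,4), of "a * t1" "b * t2"] ab t
    by (auto simp: t_def)
  have "a *\<^sub>R p1 + b *\<^sub>R p2 = ((1 - t) *\<^sub>R l - t *\<^sub>R k, t)"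
    unfolding p l(2)[symmetric] k(2)[symmetric] by (simp add: t_def algebra_simps)
  moreover have "0 \<le> t" "t \<le> 1"
    using ab t convex_bound_le[of t1 1 t2 a b] by (auto simp: t_def)
  ultimately show "a *\<^sub>R p1 + b *\<^sub>R p2 \<in> cone_sections K L"
    using k(1) l(1) by (auto simp: cone_sections_def)
qed

lemma cone_body_subset_cone_sections:
  assumes "convex K" "convex L" "K \<noteq> {}" "L \<noteq> {}"
  shows "cone_body K L \<subseteq> cone_sections K L"
  unfolding cone_body_def
proof (rule hull_minimal)
  show "convex (cone_sections K L)"
    using assms(1,2) by (rule convex_cone_sections)
  obtain k l where "k \<in> K" "l \<in> L"
    using assms by blast
  then show "(\<lambda>x. (x, 0)) ` L \<union> (\<lambda>x. (- x, 1)) ` K \<subseteq> cone_sections K L"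
    by (force simp: cone_sections_def)
qed

lemma compact_cone_body:
  assumes "compact K" "compact L"
  shows "compact (cone_body K L)"
  unfolding cone_body_def
  by (intro compact_convex_hull compact_Un compact_continuous_image assms)
     (auto intro!: continuous_intros)

section \<open>Volumes of affine images\<close>

lemma emeasure_lebesgue_compact:
  "compact S \<Longrightarrow> emeasure lebesgue S = emeasure lborel S"
  by (simp add: borel_compact)

lemma emeasure_lborel_affine_compact:
  fixes S :: "'a::euclidean_space set"
  assumes "compact S"
  shows "emeasure lborel ((\<lambda>x. m *\<^sub>R x + d) ` S) = ennreal (\<bar>m\<bar> ^ DIM('a)) * emeasure lborel S"
proof -
  have "compact ((\<lambda>x. m *\<^sub>R x + d) ` S)"
    using assms by (intro compact_continuous_image) (auto intro!: continuous_intros)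
  then show ?thesis
    using emeasure_lebesgue_affine[of m d S] assms by (simp add: emeasure_lebesgue_compact)
qed

lemma emeasure_lborel_interior_pos:
  fixes K :: "'a::euclidean_space set"
  assumes "interior K \<noteq> {}" "K \<in> sets lborel"
  shows "emeasure lborel K > 0"
proof -
  obtain x e where e: "e > 0" "ball x e \<subseteq> K"
    using assms(1) by (meson ex_in_conv mem_interior)
  have "0 < ennreal (measure lborel (ball x e))"
    using content_ball_pos[OF e(1)] by simp
  also have "\<dots> = emeasure lborel (ball x e)"
    using emeasure_lborel_ball_finite[of x e] by (simp add: emeasure_eq_ennreal_measure)
  also have "\<dots> \<le> emeasure lborel K"
    using e assms by (intro emeasure_mono) auto
  finally show ?thesis .
qed

lemma emeasure_lborel_Pair_fibres:
  fixes A :: "('a::euclidean_space \<times> 'b::euclidean_space) set"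
  assumes "A \<in> sets borel"
  shows "emeasure lborel A = (\<integral>\<^sup>+ x. emeasure lborel (Pair x -` A) \<partial>lborel)"
proof -
  have "A \<in> sets (lborel \<Otimes>\<^sub>M lborel)"
    unfolding lborel_prod using assms by simp
  from lborel.emeasure_pair_measure_alt[OF this] show ?thesis
    unfolding lborel_prod .
qed

section \<open>The incidence set\<close>

definition cone_incidence :: "'a::real_vector set \<Rightarrow> 'a set \<Rightarrow> (('a \<times> real) \<times> 'a) set" where
  "cone_incidence K L =
     {((x, t), y). 0 \<le> t \<and> t \<le> 1 \<and> y \<in> (*\<^sub>R) (1 - t) ` L \<and> y - x \<in> (*\<^sub>R) t ` K}"

lemma closed_cone_incidence:
  fixes K L :: "'a::euclidean_space set"
  assumes "compact K" "compact L"
  shows "closed (cone_incidence K L)"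
proof -
  define A where "A = (\<lambda>(t, l). (t, (1 - t) *\<^sub>R l)) ` ({0..1::real} \<times> L)"
  define B where "B = (\<lambda>(t, k). (t, t *\<^sub>R k)) ` ({0..1::real} \<times> K)"
  have "compact A" "compact B"
    unfolding A_def B_def
    by (intro compact_continuous_image compact_Times assms compact_Icc;
        auto intro!: continuous_intros simp: case_prod_unfold)+
  moreover have "cone_incidence K L =
      (\<lambda>((x, t), y). (t, y)) -` A \<inter> (\<lambda>((x, t), y). (t, y - x)) -` B"
    by (auto simp: cone_incidence_def A_def B_def image_iff)
  ultimately show ?thesis
    by (simp only:) (intro closed_Int continuous_closed_vimage compact_imp_closed;
        auto intro!: continuous_intros simp: case_prod_unfold)
qed

lemma cone_incidence_fibre_contains_translate:
  fixes K L :: "'a::euclidean_space set"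
  assumes "convex K" "convex L" "0 \<le> \<theta>" "\<theta> \<le> 1" "0 \<le> u" "u \<le> 1"
    and c: "c \<in> cone_sections K L"
  obtains d where "(\<lambda>y. u *\<^sub>R y + d) ` ((*\<^sub>R) \<theta> ` K \<inter> (*\<^sub>R) (1 - \<theta>) ` L)
      \<subseteq> Pair (u *\<^sub>R (0, \<theta>) + (1 - u) *\<^sub>R c) -` cone_incidence K L"
proof -
  obtain s l k where c: "c = ((1 - s) *\<^sub>R l - s *\<^sub>R k, s)" "0 \<le> s" "s \<le> 1" "l \<in> L" "k \<in> K"
    using c by (auto simp: cone_sections_def)
  define t where "t = u * \<theta> + (1 - u) * s"
  have t: "0 \<le> t" "t \<le> 1"
    using assms c convex_bound_le[of \<theta> 1 s u "1 - u"] by (auto simp: t_def)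
  have "y \<in> Pair (u *\<^sub>R (0, \<theta>) + (1 - u) *\<^sub>R c) -` cone_incidence K L"
    if y_mem: "y \<in> (\<lambda>y. u *\<^sub>R y + ((1 - u) * (1 - s)) *\<^sub>R l) ` ((*\<^sub>R) \<theta> ` K \<inter> (*\<^sub>R) (1 - \<theta>) ` L)" for y
  proof -
    \<comment> \<open>\<open>y\<close> is \<open>u\<close> times a point \<open>\<theta> k0 = (1 - \<theta>) l0\<close> of \<open>M\<close>, shifted by the \<open>L\<close>-part of \<open>(1 - u) c\<close>.\<close>
    obtain k0 l0 where k0: "k0 \<in> K" and l0: "l0 \<in> L" and m: "\<theta> *\<^sub>R k0 = (1 - \<theta>) *\<^sub>R l0"
      and y: "y = u *\<^sub>R (\<theta> *\<^sub>R k0) + ((1 - u) * (1 - s)) *\<^sub>R l"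
      using y_mem by blast
    have "(u * (1 - \<theta>)) + (1 - u) * (1 - s) = 1 - t"
      by (simp add: t_def algebra_simps)
    then obtain lw where lw: "lw \<in> L" "(u * (1 - \<theta>)) *\<^sub>R l0 + ((1 - u) * (1 - s)) *\<^sub>R l = (1 - t) *\<^sub>R lw"
      using convex_scaleR_add_rescale[OF assms(2) l0 c(4), of "u * (1 - \<theta>)" "(1 - u) * (1 - s)"] assms c
      by auto
    obtain kw where kw: "kw \<in> K" "(u * \<theta>) *\<^sub>R k0 + ((1 - u) * s) *\<^sub>R k = t *\<^sub>R kw"
      using convex_scaleR_add_rescale[OF assms(1) k0 c(5), of "u * \<theta>" "(1 - u) * s"] assms c
      by (auto simp: t_def)
    have "y = (1 - t) *\<^sub>R lw"
      unfolding lw(2)[symmetric] y m by simp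
    moreover have "y - (1 - u) *\<^sub>R ((1 - s) *\<^sub>R l - s *\<^sub>R k) = t *\<^sub>R kw"
      unfolding kw(2)[symmetric] y by (simp add: algebra_simps)
    ultimately show ?thesis
      using t lw(1) kw(1) c(1) by (auto simp: cone_incidence_def t_def)
  qed
  then show ?thesis
    using that by blast
qed

lemma sets_borel_cone_incidence:
  fixes K L :: "'a::euclidean_space set"
  shows "compact K \<Longrightarrow> compact L \<Longrightarrow> cone_incidence K L \<in> sets borel"
  by (rule borel_closed) (rule closed_cone_incidence)

lemma nn_integral_cone_incidence_level:
  fixes K L :: "'a::euclidean_space set"
  assumes "compact K" "compact L"
  shows "(\<integral>\<^sup>+ x. emeasure lborel (Pair (x, t) -` cone_incidence K L) \<partial>lborel)
       = ennreal (t ^ DIM('a) * (1 - t) ^ DIM('a)) * indicator {0..1} t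
         * (emeasure lborel K * emeasure lborel L)"
proof (cases "0 \<le> t \<and> t \<le> 1")
  case False
  then have "Pair (x, t) -` cone_incidence K L = {}" for x
    by (auto simp: cone_incidence_def)
  then show ?thesis
    using False by simp
next
  case True
  let ?n = "DIM('a)"
  define F where "F = (\<lambda>(x, y). ((x, t), y)) -` cone_incidence K L"
  have "closed F"
    unfolding F_def using closed_cone_incidence[OF assms]
    by (rule continuous_closed_vimage) (auto simp: case_prod_unfold intro!: continuous_intros)
  then have F_sets: "F \<in> sets (lborel \<Otimes>\<^sub>M lborel)"
    unfolding lborel_prod by simp
  have fibre: "(\<lambda>x. (x, y)) -` F
      = (if y \<in> (*\<^sub>R) (1 - t) ` L then (\<lambda>k. (- t) *\<^sub>R k + y) ` K else {})" for y
  proof -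
    have "y - x \<in> (*\<^sub>R) t ` K \<longleftrightarrow> x \<in> (\<lambda>k. (- t) *\<^sub>R k + y) ` K" for x
      by (auto simp: image_iff algebra_simps)
    then show ?thesis
      using True by (auto simp: F_def cone_incidence_def)
  qed
  have "(\<integral>\<^sup>+ x. emeasure lborel (Pair (x, t) -` cone_incidence K L) \<partial>lborel)
      = (\<integral>\<^sup>+ x. emeasure lborel (Pair x -` F) \<partial>lborel)"
    by (simp add: F_def vimage_def)
  also have "\<dots> = emeasure (lborel \<Otimes>\<^sub>M lborel) F"
    by (rule lborel.emeasure_pair_measure_alt[OF F_sets, symmetric])
  also have "\<dots> = (\<integral>\<^sup>+ y. emeasure lborel ((\<lambda>x. (x, y)) -` F) \<partial>lborel)"
    by (rule lborel_pair.emeasure_pair_measure_alt2[OF F_sets])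
  also have "\<dots> = (\<integral>\<^sup>+ y. (ennreal (t ^ ?n) * emeasure lborel K) * indicator ((*\<^sub>R) (1 - t) ` L) y \<partial>lborel)"
    using True emeasure_lborel_affine_compact[OF assms(1), of "- t"]
    by (intro nn_integral_cong) (simp add: fibre)
  also have "\<dots> = ennreal (t ^ ?n) * emeasure lborel K * emeasure lborel ((*\<^sub>R) (1 - t) ` L)"
    using assms by (simp add: nn_integral_cmult_indicator compact_scaling borel_compact)
  also have "\<dots> = ennreal (t ^ ?n) * emeasure lborel K * (ennreal ((1 - t) ^ ?n) * emeasure lborel L)"
    using emeasure_lborel_affine_compact[OF assms(2), of "1 - t" 0] True by simp
  finally show ?thesis
    using True by (simp add: ennreal_mult' mult_ac)
qed

lemma emeasure_cone_incidence:
  fixes K L :: "'a::euclidean_space set"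
  assumes "compact K" "compact L"
  shows "emeasure lborel (cone_incidence K L)
       = (\<integral>\<^sup>+ t. ennreal (t ^ DIM('a) * (1 - t) ^ DIM('a)) * indicator {0..1} t \<partial>lborel)
         * (emeasure lborel K * emeasure lborel L)"
proof -
  let ?E = "cone_incidence K L"
  have E_sets: "?E \<in> sets (lborel \<Otimes>\<^sub>M lborel)"
    unfolding lborel_prod using sets_borel_cone_incidence[OF assms] by simp
  have "emeasure lborel ?E = (\<integral>\<^sup>+ q. emeasure lborel (Pair q -` ?E) \<partial>lborel)"
    using assms by (intro emeasure_lborel_Pair_fibres sets_borel_cone_incidence)
  also have "\<dots> = (\<integral>\<^sup>+ t. \<integral>\<^sup>+ x. emeasure lborel (Pair (x, t) -` ?E) \<partial>lborel \<partial>lborel)"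
  proof -
    have "(\<lambda>q. emeasure lborel (Pair q -` ?E)) \<in> borel_measurable (lborel \<Otimes>\<^sub>M lborel)"
      unfolding lborel_prod by (rule lborel.measurable_emeasure_Pair[OF E_sets])
    from lborel_pair.nn_integral_snd[OF this] show ?thesis
      unfolding lborel_prod by simp
  qed
  also have "\<dots> = (\<integral>\<^sup>+ t. ennreal (t ^ DIM('a) * (1 - t) ^ DIM('a)) * indicator {0..1} t
                     * (emeasure lborel K * emeasure lborel L) \<partial>lborel)"
    by (simp add: nn_integral_cone_incidence_level[OF assms])
  also have "\<dots> = (\<integral>\<^sup>+ t. ennreal (t ^ DIM('a) * (1 - t) ^ DIM('a)) * indicator {0..1} t \<partial>lborel)
                  * (emeasure lborel K * emeasure lborel L)"
    by (rule nn_integral_multc) measurable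
  finally show ?thesis .
qed

section \<open>Cones shrinking a set to a point\<close>

definition shrinking_cone :: "'a::real_vector set \<Rightarrow> 'a \<Rightarrow> ('a \<times> real) set" where
  "shrinking_cone C p = (\<lambda>(c, u). (u *\<^sub>R p + (1 - u) *\<^sub>R c, u)) ` (C \<times> {0..1})"

lemma compact_shrinking_cone:
  fixes C :: "'a::euclidean_space set"
  shows "compact C \<Longrightarrow> compact (shrinking_cone C p)"
  unfolding shrinking_cone_def
  by (intro compact_continuous_image compact_Times compact_Icc)
     (auto intro!: continuous_intros simp: case_prod_unfold)

lemma emeasure_shrinking_cone_slice:
  fixes C :: "'a::euclidean_space set"
  assumes "compact C"
  shows "emeasure lborel {q. (q, u) \<in> shrinking_cone C p}
       = ennreal ((1 - u) ^ DIM('a)) * indicator {0..1} u * emeasure lborel C"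
proof (cases "0 \<le> u \<and> u \<le> 1")
  case False
  then have "{q. (q, u) \<in> shrinking_cone C p} = {}"
    by (auto simp: shrinking_cone_def)
  then show ?thesis
    using False by simp
next
  case True
  then have "{q. (q, u) \<in> shrinking_cone C p} = (\<lambda>c. (1 - u) *\<^sub>R c + u *\<^sub>R p) ` C"
    by (auto simp: shrinking_cone_def image_iff add.commute)
  then show ?thesis
    using True emeasure_lborel_affine_compact[OF assms, of "1 - u" "u *\<^sub>R p"] by simp
qed

lemma nn_integral_shrinking_cone:
  fixes C :: "'a::euclidean_space set" and f :: "real \<Rightarrow> ennreal"
  assumes "compact C" and [measurable]: "f \<in> borel_measurable borel"
  shows "(\<integral>\<^sup>+ q. \<integral>\<^sup>+ u. f u * indicator (shrinking_cone C p) (q, u) \<partial>lborel \<partial>lborel)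
       = emeasure lborel C * (\<integral>\<^sup>+ u. f u * ennreal ((1 - u) ^ DIM('a)) * indicator {0..1} u \<partial>lborel)"
proof -
  let ?G = "shrinking_cone C p"
  have G_sets[measurable]: "?G \<in> sets borel"
    using assms(1) by (intro borel_compact compact_shrinking_cone)
  then have [measurable]: "?G \<in> sets (lborel \<Otimes>\<^sub>M lborel)"
    unfolding lborel_prod by simp
  have integrand: "(\<lambda>(q, u). f u * indicator ?G (q, u)) \<in> borel_measurable (lborel \<Otimes>\<^sub>M lborel)"
    by measurable
  have "(\<integral>\<^sup>+ q. \<integral>\<^sup>+ u. f u * indicator ?G (q, u) \<partial>lborel \<partial>lborel)
      = (\<integral>\<^sup>+ u. \<integral>\<^sup>+ q. f u * indicator ?G (q, u) \<partial>lborel \<partial>lborel)"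
    using lborel_pair.Fubini'[OF integrand] by simp
  also have "\<dots> = (\<integral>\<^sup>+ u. f u * emeasure lborel {q. (q, u) \<in> ?G} \<partial>lborel)"
  proof (rule nn_integral_cong)
    fix u
    have "{q. (q, u) \<in> ?G} \<in> sets lborel"
      by measurable
    moreover have "indicator ?G (q, u) = (indicator {q. (q, u) \<in> ?G} q :: ennreal)" for q
      by (simp add: indicator_def)
    ultimately show "(\<integral>\<^sup>+ q. f u * indicator ?G (q, u) \<partial>lborel) = f u * emeasure lborel {q. (q, u) \<in> ?G}"
      by (simp add: nn_integral_cmult_indicator)
  qed
  also have "\<dots> = (\<integral>\<^sup>+ u. (f u * ennreal ((1 - u) ^ DIM('a)) * indicator {0..1} u) * emeasure lborel C \<partial>lborel)"
    by (simp add: emeasure_shrinking_cone_slice[OF assms(1)] mult.assoc)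
  also have "\<dots> = emeasure lborel C * (\<integral>\<^sup>+ u. f u * ennreal ((1 - u) ^ DIM('a)) * indicator {0..1} u \<partial>lborel)"
    by (subst nn_integral_multc) (measurable, simp add: mult.commute)
  finally show ?thesis .
qed

section \<open>The lower bound\<close>

lemma nn_integral_power_density_atLeastAtMost:
  fixes b :: real
  assumes "0 \<le> b" "n \<ge> 1"
  shows "(\<integral>\<^sup>+ u. ennreal (real n * u ^ (n - 1)) * indicator {0..b} u \<partial>lborel) = ennreal (b ^ n)"
proof -
  have "((\<lambda>u. real n * u ^ (n - 1)) has_integral b ^ n - 0 ^ n) {0..b}"
    using assms(1)
    by (intro fundamental_theorem_of_calculus)
       (auto intro!: derivative_eq_intros simp: has_real_derivative_iff_has_vector_derivative[symmetric])
  then have "((\<lambda>u. real n * u ^ (n - 1)) has_integral b ^ n) {0..b}"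
    using assms(2) by (simp add: power_0_left)
  then show ?thesis
    by (rule nn_integral_has_integral_lebesgue'[rotated]) simp
qed

lemma nn_integral_power_density_le:
  fixes m \<phi> :: ennreal and A :: "real set"
  assumes n: "n \<ge> 1" and "m < \<infinity>"
    and bound: "\<And>u. u \<in> A \<Longrightarrow> 0 \<le> u \<and> ennreal (u ^ n) * m \<le> \<phi>"
  shows "m * (\<integral>\<^sup>+ u. ennreal (real n * u ^ (n - 1)) * indicator A u \<partial>lborel) \<le> \<phi>"
proof (cases "m = 0 \<or> \<phi> = \<infinity>")
  case True
  then show ?thesis by auto
next
  case False
  then obtain mr fr where mr: "m = ennreal mr" "mr > 0" and fr: "\<phi> = ennreal fr" "fr \<ge> 0"
    using assms(2) by (cases m; cases \<phi>) auto
  \<comment> \<open>\<open>A\<close> lies in \<open>[0, b]\<close> with \<open>b^n = \<phi> / m\<close>, and the density integrates to \<open>b^n\<close> over \<open>[0, b]\<close>.\<close>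
  define b where "b = root n (fr / mr)"
  have b: "0 \<le> b" "b ^ n = fr / mr"
    using n mr fr by (auto simp: b_def)
  have "A \<subseteq> {0..b}"
  proof
    fix u assume "u \<in> A"
    then have u: "0 \<le> u" "ennreal (u ^ n * mr) \<le> ennreal fr"
      using bound mr fr by (auto simp: ennreal_mult)
    then have "mr * u ^ n \<le> mr * b ^ n"
      using mr b fr by (simp add: field_simps)
    then have "u ^ n \<le> b ^ n"
      using mr(2) by simp
    then have "u \<le> b"
      using n b(1) by (intro power_le_imp_le_base[of u "n - 1"]) simp_all
    then show "u \<in> {0..b}"
      using u by simp
  qed
  then have "(\<integral>\<^sup>+ u. ennreal (real n * u ^ (n - 1)) * indicator A u \<partial>lborel)
      \<le> (\<integral>\<^sup>+ u. ennreal (real n * u ^ (n - 1)) * indicator {0..b} u \<partial>lborel)"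
    by (intro nn_integral_mono mult_left_mono) (auto simp: indicator_def)
  also have "\<dots> = ennreal (fr / mr)"
    using nn_integral_power_density_atLeastAtMost[OF b(1) n] b(2) by simp
  finally show ?thesis
    using mr fr by (auto simp: ennreal_mult'[symmetric] intro: order.trans[OF mult_left_mono])
qed

lemma emeasure_cone_incidence_fibre_ge:
  fixes K L :: "'a::euclidean_space set"
  assumes "compact K" "compact L" "convex K" "convex L" "K \<noteq> {}" "L \<noteq> {}" "0 \<le> \<theta>" "\<theta> \<le> 1"
    and "(q, u) \<in> shrinking_cone (cone_body K L) (0, \<theta>)"
  shows "0 \<le> u \<and> ennreal (u ^ DIM('a)) * emeasure lborel ((*\<^sub>R) \<theta> ` K \<inter> (*\<^sub>R) (1 - \<theta>) ` L)
           \<le> emeasure lborel (Pair q -` cone_incidence K L)"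
proof -
  let ?M = "(*\<^sub>R) \<theta> ` K \<inter> (*\<^sub>R) (1 - \<theta>) ` L"
  obtain c where c: "c \<in> cone_body K L" and u: "0 \<le> u" "u \<le> 1"
    and q: "q = u *\<^sub>R (0, \<theta>) + (1 - u) *\<^sub>R c"
    using assms(9) by (auto simp: shrinking_cone_def)
  have "c \<in> cone_sections K L"
    using c cone_body_subset_cone_sections[OF assms(3-6)] by blast
  then obtain d where d: "(\<lambda>y. u *\<^sub>R y + d) ` ?M \<subseteq> Pair q -` cone_incidence K L"
    using cone_incidence_fibre_contains_translate[OF assms(3,4,7,8) u] unfolding q by blast
  have "compact ?M"
    using assms(1,2) by (intro compact_Int compact_scaling)
  then have "ennreal (u ^ DIM('a)) * emeasure lborel ?M = emeasure lborel ((\<lambda>y. u *\<^sub>R y + d) ` ?M)"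
    using u by (simp add: emeasure_lborel_affine_compact)
  also have "\<dots> \<le> emeasure lborel (Pair q -` cone_incidence K L)"
    using d assms(1,2)
    by (intro emeasure_mono)
       (auto intro!: borel_closed continuous_closed_vimage closed_cone_incidence continuous_intros)
  finally show ?thesis
    using u by simp
qed

lemma emeasure_cone_incidence_ge:
  fixes K L :: "'a::euclidean_space set"
  assumes "compact K" "compact L" "convex K" "convex L" "K \<noteq> {}" "L \<noteq> {}" "0 \<le> \<theta>" "\<theta> \<le> 1"
  shows "emeasure lborel ((*\<^sub>R) \<theta> ` K \<inter> (*\<^sub>R) (1 - \<theta>) ` L)
           * (emeasure lborel (cone_body K L)
              * (\<integral>\<^sup>+ u. ennreal (real DIM('a) * u ^ (DIM('a) - 1)) * ennreal ((1 - u) ^ (DIM('a) + 1))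
                       * indicator {0..1} u \<partial>lborel))
         \<le> emeasure lborel (cone_incidence K L)"
proof -
  let ?m = "emeasure lborel ((*\<^sub>R) \<theta> ` K \<inter> (*\<^sub>R) (1 - \<theta>) ` L)"
    and ?G = "shrinking_cone (cone_body K L) (0, \<theta>)"
    and ?f = "\<lambda>u. ennreal (real DIM('a) * u ^ (DIM('a) - 1))"
  have n: "DIM('a) \<ge> 1"
    by (simp add: Suc_le_eq)
  have m_finite: "?m < \<infinity>"
    using assms(1,2)
    by (intro emeasure_bounded_finite compact_imp_bounded compact_Int compact_scaling)
  have fibre: "?m * (\<integral>\<^sup>+ u. ?f u * indicator ?G (q, u) \<partial>lborel)
      \<le> emeasure lborel (Pair q -` cone_incidence K L)" for q
  proof -
    have "?m * (\<integral>\<^sup>+ u. ?f u * indicator {u. (q, u) \<in> ?G} u \<partial>lborel)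
        \<le> emeasure lborel (Pair q -` cone_incidence K L)"
      using n m_finite
      by (rule nn_integral_power_density_le) (use emeasure_cone_incidence_fibre_ge[OF assms] in auto)
    then show ?thesis
      by (simp add: indicator_def)
  qed
  have G_sets[measurable]: "?G \<in> sets (lborel \<Otimes>\<^sub>M lborel)"
    unfolding lborel_prod using assms(1,2)
    by (simp add: borel_compact compact_shrinking_cone compact_cone_body)
  have "?m * (emeasure lborel (cone_body K L)
          * (\<integral>\<^sup>+ u. ?f u * ennreal ((1 - u) ^ (DIM('a) + 1)) * indicator {0..1} u \<partial>lborel))
      = ?m * (\<integral>\<^sup>+ q. \<integral>\<^sup>+ u. ?f u * indicator ?G (q, u) \<partial>lborel \<partial>lborel)"
    using nn_integral_shrinking_cone[OF compact_cone_body[OF assms(1,2)], of ?f "(0, \<theta>)"] by simp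
  also have "\<dots> = (\<integral>\<^sup>+ q. ?m * (\<integral>\<^sup>+ u. ?f u * indicator ?G (q, u) \<partial>lborel) \<partial>lborel)"
  proof (rule nn_integral_cmult[symmetric])
    have "(\<lambda>(q, u). ?f u * indicator ?G (q, u)) \<in> borel_measurable (lborel \<Otimes>\<^sub>M lborel)"
      by measurable
    from lborel.borel_measurable_nn_integral_fst[OF this]
    show "(\<lambda>q. \<integral>\<^sup>+ u. ?f u * indicator ?G (q, u) \<partial>lborel) \<in> borel_measurable lborel"
      by simp
  qed
  also have "\<dots> \<le> (\<integral>\<^sup>+ q. emeasure lborel (Pair q -` cone_incidence K L) \<partial>lborel)"
    using fibre by (rule nn_integral_mono)
  also have "\<dots> = emeasure lborel (cone_incidence K L)"
    using assms(1,2) by (intro emeasure_lborel_Pair_fibres[symmetric] sets_borel_cone_incidence)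
  finally show ?thesis .
qed

section \<open>Two Beta integrals\<close>

lemma has_integral_power_mult_power:
  assumes "n \<ge> 1"
  shows "((\<lambda>t::real. t ^ n * (1 - t) ^ n) has_integral Beta (real n + 1) (real n + 1)) {0..1}"
proof -
  have powr_eq: "x powr real n = x ^ n" if "0 \<le> x" for x :: real
    using that assms by (cases "x = 0") (auto simp: powr_realpow)
  have "((\<lambda>t. t powr (real n + 1 - 1) * (1 - t) powr (real n + 1 - 1))
          has_integral Beta (real n + 1) (real n + 1)) {0..1}"
    by (rule has_integral_Beta_real) auto
  then show ?thesis
    by (rule has_integral_eq[rotated]) (simp add: powr_eq)
qed

lemma nn_integral_power_density_mult_power:
  assumes n: "n \<ge> 1"
  shows "(\<integral>\<^sup>+ u. ennreal (real n * u ^ (n - 1)) * ennreal ((1 - u) ^ (n + 1)) * indicator {0..1} u \<partial>lborel)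
       = ennreal ((real n + 1) * Beta (real n + 1) (real n + 1))"
proof -
  let ?g = "\<lambda>u::real. real n * u ^ (n - 1) * (1 - u) ^ (n + 1)"
  \<comment> \<open>Integration by parts: the boundary term \<open>u^n (1 - u)^(n+1)\<close> vanishes at both ends.\<close>
  have "((\<lambda>u. u ^ n * (1 - u) ^ (n + 1)) has_real_derivative
           ?g u - (real n + 1) * (u ^ n * (1 - u) ^ n)) (at u within {0..1})" for u
    by (rule derivative_eq_intros refl | simp)+
  then have "((\<lambda>u. ?g u - (real n + 1) * (u ^ n * (1 - u) ^ n))
          has_integral (1 ^ n * (1 - 1) ^ (n + 1) - 0 ^ n * (1 - 0) ^ (n + 1))) {0..1}"
    by (intro fundamental_theorem_of_calculus)
       (simp_all add: has_real_derivative_iff_has_vector_derivative[symmetric])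
  then have "((\<lambda>u. ?g u - (real n + 1) * (u ^ n * (1 - u) ^ n)) has_integral 0) {0..1}"
    using n by (simp add: power_0_left)
  from has_integral_add[OF this has_integral_mult_right[OF has_integral_power_mult_power[OF n], where c = "real n + 1"]]
  have "(?g has_integral (real n + 1) * Beta (real n + 1) (real n + 1)) {0..1}"
    by simp
  then have "(\<integral>\<^sup>+ u. ennreal (?g u) * indicator {0..1} u \<partial>lborel)
      = ennreal ((real n + 1) * Beta (real n + 1) (real n + 1))"
    by (rule nn_integral_has_integral_lebesgue'[rotated]) simp
  moreover have "ennreal (?g u) * indicator {0..1} u
      = ennreal (real n * u ^ (n - 1)) * ennreal ((1 - u) ^ (n + 1)) * indicator {0..1} u" for u
    by (auto simp: indicator_def ennreal_mult)
  ultimately show ?thesis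
    by simp
qed

section \<open>The volume inequality\<close>

lemma emeasure_cone_body_mult_le:
  fixes K L :: "'a::euclidean_space set"
  assumes "compact K" "compact L" "convex K" "convex L" "K \<noteq> {}" "L \<noteq> {}" "0 \<le> \<theta>" "\<theta> \<le> 1"
  shows "emeasure lborel (cone_body K L) * emeasure lborel ((*\<^sub>R) \<theta> ` K \<inter> (*\<^sub>R) (1 - \<theta>) ` L)
         \<le> ennreal (1 / real (DIM('a) + 1)) * emeasure lborel K * emeasure lborel L"
proof -
  let ?B = "Beta (real DIM('a) + 1) (real DIM('a) + 1)" and ?c = "ennreal (1 / real (DIM('a) + 1))"
    and ?m = "emeasure lborel ((*\<^sub>R) \<theta> ` K \<inter> (*\<^sub>R) (1 - \<theta>) ` L)"
  have n: "DIM('a) \<ge> 1"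
    by (simp add: Suc_le_eq)
  have "0 < ?B"
    by (simp add: Beta_def)
  then have B: "ennreal ?B \<noteq> 0" "ennreal ?B \<noteq> \<infinity>"
    by simp_all
  have scale: "?c * ennreal ((real DIM('a) + 1) * ?B) = ennreal ?B"
    using \<open>0 < ?B\<close> by (simp add: ennreal_mult[symmetric] add.commute)
  have "ennreal ?B * (emeasure lborel (cone_body K L) * ?m)
      = ?c * (?m * (emeasure lborel (cone_body K L)
           * (\<integral>\<^sup>+ u. ennreal (real DIM('a) * u ^ (DIM('a) - 1)) * ennreal ((1 - u) ^ (DIM('a) + 1))
                    * indicator {0..1} u \<partial>lborel)))"
    unfolding nn_integral_power_density_mult_power[OF n] scale[symmetric] by (simp only: ac_simps)
  also have "\<dots> \<le> ?c * emeasure lborel (cone_incidence K L)"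
    by (intro mult_left_mono emeasure_cone_incidence_ge[OF assms]) simp
  also have "\<dots> = ennreal ?B * (?c * emeasure lborel K * emeasure lborel L)"
    unfolding emeasure_cone_incidence[OF assms(1,2)]
    by (subst nn_integral_has_integral_lebesgue'[OF _ has_integral_power_mult_power[OF n]])
       (simp_all add: ac_simps)
  finally show ?thesis
    using B by (simp add: ennreal_mult_le_mult_iff)
qed

lemma ennreal_le_divide_of_mult_le:
  fixes c m y :: ennreal
  assumes "c * m \<le> y" "y \<noteq> 0" "m \<noteq> \<infinity>"
  shows "c \<le> y / m"
proof (cases "m = 0")
  case True
  then show ?thesis
    using assms(2) by simp
next
  case False
  then have "c = c * m / m"
    using assms(3) by (simp add: mult_divide_eq_ennreal)
  also have "\<dots> \<le> y / m"
    using assms(1) by (rule divide_right_mono_ennreal)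
  finally show ?thesis .
qed

theorem theorem5p2:
  fixes K L :: "'a::euclidean_space set" and \<theta> :: real
  assumes "convex_body K" and "convex_body L" and "0 \<le> \<theta>" and "\<theta> \<le> 1"
  shows "emeasure lebesgue (cone_body K L)
           \<le> ennreal (1 / real (DIM('a) + 1)) * emeasure lebesgue K * emeasure lebesgue L
              / emeasure lebesgue ((\<lambda>x. \<theta> *\<^sub>R x) ` K \<inter> (\<lambda>x. (1 - \<theta>) *\<^sub>R x) ` L)"
proof -
  let ?M = "(*\<^sub>R) \<theta> ` K \<inter> (*\<^sub>R) (1 - \<theta>) ` L"
  have K: "compact K" "convex K" "interior K \<noteq> {}" and L: "compact L" "convex L" "interior L \<noteq> {}"
    using assms(1,2) by (auto simp: convex_body_def)
  then have nonempty: "K \<noteq> {}" "L \<noteq> {}"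
    by auto
  have M: "compact ?M"
    using K L by (intro compact_Int compact_scaling)
  have "emeasure lborel (cone_body K L) * emeasure lborel ?M
      \<le> ennreal (1 / real (DIM('a) + 1)) * emeasure lborel K * emeasure lborel L"
    by (rule emeasure_cone_body_mult_le[OF K(1) L(1) K(2) L(2) nonempty assms(3,4)])
  moreover have "emeasure lborel K * emeasure lborel L \<noteq> 0"
    using K L by (auto dest!: emeasure_lborel_interior_pos simp: borel_compact)
  moreover have "emeasure lborel ?M \<noteq> \<infinity>"
    using emeasure_bounded_finite[OF compact_imp_bounded[OF M]] by simp
  ultimately show ?thesis
    using K(1) L(1) M compact_cone_body[OF K(1) L(1)]
    by (simp add: emeasure_lebesgue_compact ennreal_le_divide_of_mult_le)
qed

end
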